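(* Let $1\le n<P$ be integers, let $G=\{0,\dots,P-1\}$ index $P$ control qubits, and let $t$ be a target qubit distinct from the qubits in $G$. Let $S_2=\{a^j\}_{j=0}^{2^n-1}\subset\{0,1\}^P$, with $a^j=(a^j_i)_{i\in G}$. Suppose there exists a subset $F\subset G$ with $|F|=P-n$ such that $$a^j_i=a^k_i\quad\text{for all } i\in F \text{ and all } j,k\in\{0,\dots,2^n-1\},$$ and such that the substrings on the remaining indices satisfy $$\{(a^j_i)_{i\in G\setminus F}\}_{j=0}^{2^n-1}=\{0,1\}^n .$$ Then $$\prod_{j=0}^{2^n-1}C_G^{|a^j\rangle}X_{|t\rangle}=C_F^{|\tilde a\rangle}X_{|t\rangle},$$ where $|\tilde a\rangle=\bigotimes_{i\in F}|a_i\rangle$ and $a_i$ denotes the common value of $a^j_i$ over all $j$, for $i\in F$.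
   Context: For a set $H$ of control qubits, a bit string $c\in\{0,1\}^H$ and a target qubit $t\notin H$, the multi-controlled NOT (MCX) gate is $$C_H^{|c\rangle}X_{|t\rangle}=|c\rangle\langle c|_H\otimes X_{t}+(I-|c\rangle\langle c|)_H\otimes I_{t},$$ where $X$ is the Pauli NOT gate, acting as the identity on all other qubits. That is, it flips qubit $t$ exactly when the control qubits in $H$ are in the computational basis state $c$. Operators on both sides of the claimed identity act on the space of the $P$ qubits of $G$ together with the target qubit $t$. *)

theory Defs
  imports "HOL-Analysis.Analysis"
begin

text \<open>
  The finite type \<open>'q\<close> is the set of all qubits. The state space is spanned by the kets of the
  bit strings \<open>'q \<Rightarrow> bool\<close>, and operators are given by their matrices in this basis
  (rows indexed first).
\<close>

type_synonym 'q bits = "'q \<Rightarrow> bool"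
type_synonym 'q operator = "complex ^ ('q bits) ^ ('q bits)"

text \<open>The set \<open>{0,1}\<^sup>H\<close>. Strings on a subset \<open>H\<close> of the qubits are extensional functions,
  \<open>undefined\<close> outside \<open>H\<close>, so that equality of strings is equality on \<open>H\<close>.\<close>

definition bitstrings :: "'q set \<Rightarrow> 'q bits set" where
  "bitstrings H = H \<rightarrow>\<^sub>E (UNIV :: bool set)"

text \<open>The subset \<open>H\<close> is not a type, so an operator on the register \<open>H\<close> is a function of its row and
  column indices; only its entries at \<open>bitstrings H\<close> are relevant.\<close>

type_synonym 'q reg_operator = "'q bits \<Rightarrow> 'q bits \<Rightarrow> complex"

definition ket :: "'q bits \<Rightarrow> 'q bits \<Rightarrow> complex" where
  "ket c = (\<lambda>x. of_bool (x = c))"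

definition ket_bra :: "'q bits \<Rightarrow> 'q reg_operator" where
  "ket_bra c = (\<lambda>x y. ket c x * cnj (ket c y))"

definition reg_id :: "'q reg_operator" where
  "reg_id = (\<lambda>x y. of_bool (x = y))"

definition pauli_X :: "complex ^ bool ^ bool" where
  "pauli_X = (\<chi> b b'. of_bool (b \<noteq> b'))"

text \<open>\<open>A\<^sub>H \<otimes> B\<^sub>t\<close>, tensored with the identity on all qubits outside \<open>H \<union> {t}\<close>
  (meaningful for \<open>t \<notin> H\<close>).\<close>

definition reg_tensor ::
  "('q::finite) set \<Rightarrow> 'q reg_operator \<Rightarrow> 'q \<Rightarrow> complex ^ bool ^ bool \<Rightarrow> 'q operator" where
  "reg_tensor H A t B =
     (\<chi> x y. A (restrict x H) (restrict y H) * B $ x t $ y t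
              * of_bool (\<forall>i. i \<notin> insert t H \<longrightarrow> x i = y i))"

text \<open>The subtraction in \<open>reg_id - ket_bra c\<close> is pointwise.\<close>

definition mcx :: "('q::finite) set \<Rightarrow> 'q bits \<Rightarrow> 'q \<Rightarrow> 'q operator" where
  "mcx H c t = reg_tensor H (ket_bra c) t pauli_X
             + reg_tensor H (reg_id - ket_bra c) t (mat 1)"

text \<open>\<open>op_prod [A\<^sub>0, \<dots>, A\<^sub>m] = A\<^sub>0 ** \<dots> ** A\<^sub>m\<close>; the type-class product
  on vectors is componentwise and hence not the one needed here.\<close>

definition op_prod :: "('q::finite) operator list \<Rightarrow> 'q operator" where
  "op_prod As = foldr (**) As (mat 1)"

lemma mcx_basis_state:
  fixes H :: "('q::finite) set"
  assumes "t \<notin> H"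
  shows "mcx H c t *v axis x 1 =
           axis (if restrict x H = c then x(t := \<not> x t) else x) 1"
proof -
  have agree: "y = z \<longleftrightarrow>
      restrict y H = restrict z H \<and> y t = z t \<and> (\<forall>i. i \<notin> insert t H \<longrightarrow> y i = z i)"
    for y z :: "'q bits"
    by (auto simp: fun_eq_iff restrict_def)
  have upd: "restrict (x(t := b)) H = restrict x H" for b
    using assms by (auto simp: fun_eq_iff restrict_def)
  have "(mcx H c t *v axis x 1) $ y =
          axis (if restrict x H = c then x(t := \<not> x t) else x) 1 $ y" for y
  proof -
    have "(mcx H c t *v axis x 1) $ y = mcx H c t $ y $ x"
      by (simp add: matrix_vector_mult_def axis_def if_distrib cong: if_cong)
    also have "\<dots> = of_bool (y = (if restrict x H = c then x(t := \<not> x t) else x))"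
      unfolding agree[of y] mcx_def reg_tensor_def ket_bra_def ket_def reg_id_def pauli_X_def
        mat_def
      by (auto simp: upd)
    finally show ?thesis by (simp add: axis_def)
  qed
  then show ?thesis by (simp add: vec_eq_iff)
qed

end

theory Submission
  imports Defs
begin

text \<open>
  On a basis state \<open>x\<close>, a product of gates with the same controls and distinct control strings
  flips \<open>t\<close> exactly when the restriction of \<open>x\<close> to the controls occurs among these strings. By
  counting, the \<open>2\<^sup>n\<close> strings \<open>a\<^sup>j\<close> are distinct, and they are exactly the strings on \<open>G\<close> that
  extend the common string on \<open>F\<close>.
\<close>

text \<open>The image of a basis vector is a column of the matrix. This reduces the operator
  identity to basis states, which every gate permutes.\<close>

lemma matrix_eq_on_axisI:
  fixes A B :: "('a::semiring_1) ^ ('n::finite) ^ 'm"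
  assumes "\<And>x. A *v axis x 1 = B *v axis x 1"
  shows "A = B"
proof -
  have entry: "(M *v axis y 1) $ x = M $ x $ y" for M :: "'a ^ 'n ^ 'm" and x y
    by (simp add: matrix_vector_mult_def axis_def if_distrib cong: if_cong)
  have "A $ x $ y = B $ x $ y" for x y
    using arg_cong[OF assms[of y], of "\<lambda>v. v $ x"] by (simp only: entry)
  then show ?thesis by (simp add: vec_eq_iff)
qed

text \<open>Since \<open>t\<close> lies outside \<open>H\<close>, a flip leaves the controls
  unchanged, so every gate tests the original \<open>x\<close>. Distinctness lets at most one gate
  fire; two equal strings would cancel.\<close>

lemma op_prod_mcx_basis_state:
  fixes H :: "('q::finite) set"
  assumes "t \<notin> H" and "distinct cs"
  shows "op_prod (map (\<lambda>c. mcx H c t) cs) *v axis x 1 =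
           axis (if restrict x H \<in> set cs then x(t := \<not> x t) else x) 1"
  using assms(2)
proof (induction cs)
  case Nil
  then show ?case by (simp add: op_prod_def)
next
  case (Cons c cs)
  have upd: "restrict (x(t := b)) H = restrict x H" for b
    using assms(1) by (auto simp: fun_eq_iff restrict_def)
  have "op_prod (map (\<lambda>c. mcx H c t) (c # cs)) *v axis x 1 =
          mcx H c t *v (op_prod (map (\<lambda>c. mcx H c t) cs) *v axis x 1)"
    by (simp add: op_prod_def matrix_vector_mul_assoc)
  also have "\<dots> = mcx H c t *v axis (if restrict x H \<in> set cs then x(t := \<not> x t) else x) 1"
    by (subst Cons.IH) (use Cons.prems in simp_all)
  also have "\<dots> = axis (if restrict x H \<in> set (c # cs) then x(t := \<not> x t) else x) 1"
    using Cons.prems by (auto simp: mcx_basis_state[OF assms(1)] upd)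
  finally show ?case .
qed

lemma card_bitstrings:
  fixes H :: "('q::finite) set"
  shows "card (bitstrings H) = 2 ^ card H"
  by (simp add: bitstrings_def card_PiE)

theorem theorem2:
  fixes n P :: nat
    and G F :: "('q::finite) set"
    and t :: 'q
    and a :: "nat \<Rightarrow> 'q bits"
    and a_tilde :: "'q bits"
  assumes "1 \<le> n" and "n < P"
    and "card G = P" and "t \<notin> G" and "insert t G = UNIV"
    and "\<And>j. j < 2 ^ n \<Longrightarrow> a j \<in> bitstrings G"
    and "F \<subseteq> G" and "card F = P - n"
    and "\<And>i j k. i \<in> F \<Longrightarrow> j < 2 ^ n \<Longrightarrow> k < 2 ^ n \<Longrightarrow> a j i = a k i"
    and "(\<lambda>j. restrict (a j) (G - F)) ` {..<2 ^ n} = bitstrings (G - F)"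
    and "a_tilde \<in> bitstrings F"
    and "\<And>i j. i \<in> F \<Longrightarrow> j < 2 ^ n \<Longrightarrow> a_tilde i = a j i"
  shows "op_prod (map (\<lambda>j. mcx G (a j) t) [0..<2 ^ n]) = mcx F a_tilde t"
proof (rule matrix_eq_on_axisI)
  fix x :: "'q bits"
  have "card (G - F) = n"
    using assms(2,3,7,8) by (simp add: card_Diff_subset)
  \<comment> \<open>The \<open>2 ^ n\<close> indices map onto the \<open>2 ^ n\<close> strings on
    \<open>G - F\<close>, so this map is injective, and hence so is \<open>a\<close>.\<close>
  then have "card ((\<lambda>j. restrict (a j) (G - F)) ` {..<2 ^ n}) = card {..<(2::nat) ^ n}"
    using assms(10) by (simp add: card_bitstrings)
  then have "inj_on (\<lambda>j. restrict (a j) (G - F)) {..<2 ^ n}"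
    by (simp add: eq_card_imp_inj_on)
  then have "inj_on a {..<2 ^ n}"
    by (auto simp: inj_on_def)
  then have dist: "distinct (map a [0..<2 ^ n])"
    by (simp add: distinct_map atLeast0LessThan)
  have "restrict x G \<in> a ` {..<2 ^ n} \<longleftrightarrow> restrict x F = a_tilde"
  proof
    assume "restrict x G \<in> a ` {..<2 ^ n}"
    then obtain j where j: "j < 2 ^ n" "restrict x G = a j" by auto
    show "restrict x F = a_tilde"
    \<comment> \<open>Both strings are extensional on \<open>F\<close>, so only indices in
      \<open>F\<close> need comparing.\<close>
    proof (rule PiE_ext)
      show "a_tilde \<in> F \<rightarrow>\<^sub>E UNIV"
        using assms(11) by (simp add: bitstrings_def)
      show "restrict x F i = a_tilde i" if "i \<in> F" for i
        using that subsetD[OF assms(7) that] assms(12)[OF that j(1)] fun_cong[OF j(2), of i] by simp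
    qed auto
  next
    assume xF: "restrict x F = a_tilde"
    have "restrict x (G - F) \<in> bitstrings (G - F)"
      by (simp add: bitstrings_def)
    \<comment> \<open>All strings on \<open>G - F\<close> occur, so some \<open>a j\<close> has the
      free bits of \<open>x\<close>.\<close>
    then obtain j where j: "j < 2 ^ n" "restrict x (G - F) = restrict (a j) (G - F)"
      unfolding assms(10)[symmetric] by auto
    have "restrict x G = a j"
    proof (rule PiE_ext)
      show "a j \<in> G \<rightarrow>\<^sub>E UNIV"
        using assms(6)[OF j(1)] by (simp add: bitstrings_def)
      show "restrict x G i = a j i" if "i \<in> G" for i
      \<comment> \<open>On \<open>F\<close> both strings agree with \<open>a_tilde\<close>;
        elsewhere they agree by the choice of \<open>j\<close>.\<close>
      proof (cases "i \<in> F")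
        case True
        then show ?thesis
          using that assms(12)[OF True j(1)] fun_cong[OF xF, of i] by simp
      next
        case False
        then show ?thesis
          using that fun_cong[OF j(2), of i] by simp
      qed
    qed auto
    then show "restrict x G \<in> a ` {..<2 ^ n}"
      using j(1) by auto
  qed
  moreover have "t \<notin> F"
    using assms(4,7) by auto
  \<comment> \<open>Both sides flip \<open>t\<close> in \<open>x\<close>, under conditions just
    shown equivalent.\<close>
  ultimately show "op_prod (map (\<lambda>j. mcx G (a j) t) [0..<2 ^ n]) *v axis x 1 =
      mcx F a_tilde t *v axis x 1"
    using op_prod_mcx_basis_state[OF assms(4) dist, of x]
    by (simp add: mcx_basis_state comp_def atLeast0LessThan)
qed

end
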